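(* Let $X,Y$ be two separated nets in $\mathbb{R}^d$. Then there is a bijection $f\colon X\to Y$ such that $\operatorname{disp}_R(f)\in O(R)$ and $\operatorname{disp}_R(f^{-1})\in O(R)$.
   Context: A set $Z\subseteq\mathbb{R}^d$ is separated if $\inf\{\|z-z'\|_2: z,z'\in Z,\ z\ne z'\}>0$, and a net of $\mathbb{R}^d$ if $\sup_{x\in\mathbb{R}^d}\inf_{z\in Z}\|z-x\|_2<\infty$; a separated net is a set that is both. For $f\colon A\subseteq\mathbb{R}^d\to\mathbb{R}^d$ and $R>0$, $\operatorname{disp}_R(f):=\sup\{\|f(x)-x\|_2: x\in A,\ \|x\|_2\le R\}$, with $\operatorname{disp}_R(f):=0$ if $A\cap\overline{B}(\mathbf{0},R)=\emptyset$. Here $u(R)\in O(R)$ means $\limsup_{R\to\infty}u(R)/R<\infty$. *)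

theory Defs
  imports "HOL-Analysis.Analysis"
begin

text \<open>All infima, suprema and limits superior are taken in the extended reals, so that
  the infimum of the empty set is \<open>\<infinity>\<close> (a set with at most one point is separated, the empty
  set is not a net) and an unbounded set has supremum \<open>\<infinity>\<close>.\<close>

definition separated :: "(real ^ 'n) set \<Rightarrow> bool" where
  "separated Z \<longleftrightarrow>
     Inf {ereal (norm (z - z')) | z z'. z \<in> Z \<and> z' \<in> Z \<and> z \<noteq> z'} > 0"

definition net :: "(real ^ 'n) set \<Rightarrow> bool" where
  "net Z \<longleftrightarrow> (SUP x. INF z\<in>Z. ereal (norm (z - x))) < \<infinity>"

definition separated_net :: "(real ^ 'n) set \<Rightarrow> bool" where
  "separated_net Z \<longleftrightarrow> separated Z \<and> net Z"

text \<open>The domain \<open>A\<close> of a partial map is passed explicitly; values of \<open>f\<close> outside \<open>A\<close> are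
  irrelevant. The case distinction is needed because \<open>Sup {} = -\<infinity>\<close> in \<open>ereal\<close>.\<close>

definition disp :: "(real ^ 'n) set \<Rightarrow> (real ^ 'n \<Rightarrow> real ^ 'n) \<Rightarrow> real \<Rightarrow> ereal" where
  "disp A f R =
     (if A \<inter> cball 0 R = {} then 0
      else Sup {ereal (norm (f x - x)) | x. x \<in> A \<and> norm x \<le> R})"

text \<open>\<open>u(R) \<in> O(R)\<close>, i.e. \<open>limsup u(R)/R < \<infinity>\<close> as \<open>R \<rightarrow> \<infinity>\<close>, for extended-real-valued \<open>u\<close>.\<close>

definition linear_growth :: "(real \<Rightarrow> ereal) \<Rightarrow> bool" where
  "linear_growth u \<longleftrightarrow> Limsup at_top (\<lambda>R. u R / ereal R) < \<infinity>"

end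

theory Submission imports Defs
begin

text \<open>
  Cantor--Bernstein, with the two injections built so that each of them changes norms by at most a
  linear amount. If distinct points of \<open>X\<close> are at least \<open>s\<close> apart and every point of space is
  within \<open>\<rho>\<close> of \<open>Y\<close>, dilate \<open>X\<close> by a factor \<open>L\<close> with \<open>L * s > 2 * \<rho>\<close> and send \<open>x\<close> to a point of
  \<open>Y\<close> within \<open>\<rho>\<close> of \<open>L x\<close>. Distinct points of \<open>X\<close> become more than \<open>2 * \<rho>\<close> apart, so they
  cannot share an image. Thus the separation of \<open>X\<close> and the density of \<open>Y\<close> give an injection
  \<open>g : X \<rightarrow> Y\<close> that moves \<open>x\<close> by at most a linear function of \<open>\<parallel>x\<parallel>\<close> and, as \<open>\<parallel>x\<parallel>\<close> is itself
  controlled by \<open>\<parallel>g x\<parallel>\<close>, also by at most a linear function of \<open>\<parallel>g x\<parallel>\<close>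
  (\<open>injection_of_linear_displacement\<close>). Exchanging the roles gives \<open>h : Y \<rightarrow> X\<close> of the same kind.

  The bijection produced by the Cantor--Bernstein argument pairs \<open>x\<close> with \<open>y\<close> only if \<open>y = g x\<close> or
  \<open>x = h y\<close> (\<open>Cantor_Bernstein_within_graphs\<close>). The displacement bounds are symmetric in the two
  ends of a pair, so they pass to the bijection and to its inverse.
\<close>

text \<open>The bijection follows \<open>g\<close> on one part of \<open>A\<close> and goes back along \<open>h\<close> on the rest. Keeping this
  information, beyond mere existence of a bijection, is what lets estimates on the injections pass
  to it.\<close>

lemma Cantor_Bernstein_within_graphs:
  assumes "inj_on g A" "g ` A \<subseteq> B" "inj_on h B" "h ` B \<subseteq> A"
  obtains f where "bij_betw f A B" "\<And>x. x \<in> A \<Longrightarrow> f x = g x \<or> h (f x) = x"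
proof -
  \<comment> \<open>\<open>S\<close> contains the points outside the image of \<open>h\<close> and everything reached from them by
    alternating \<open>g\<close> and \<open>h\<close>; outside \<open>S\<close> it is possible to go back along \<open>h\<close>.\<close>
  define S where "S = lfp (\<lambda>S. A - h ` (B - g ` S))"
  have "mono (\<lambda>S. A - h ` (B - g ` S))"
    by (intro monoI) blast
  then have S: "S = A - h ` (B - g ` S)"
    unfolding S_def by (rule lfp_unfold)
  have compl: "A - S = h ` (B - g ` S)"
    using S assms(4) by blast
  define f where "f x = (if x \<in> S then g x else inv_into B h x)" for x
  have "bij_betw g S (g ` S)"
    using S assms(1) by (intro inj_on_imp_bij_betw) (blast intro: inj_on_subset)
  then have f_S: "bij_betw f S (g ` S)"
    by (rule bij_betw_cong[THEN iffD1, rotated]) (simp add: f_def)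
  have "bij_betw (inv_into B h) (A - S) (B - g ` S)"
    using assms(3) compl by (intro bij_betw_inv_into_subset[of h B "h ` B"]) (auto simp: bij_betw_def)
  then have f_compl: "bij_betw f (A - S) (B - g ` S)"
    by (rule bij_betw_cong[THEN iffD1, rotated]) (simp add: f_def)
  have "bij_betw f (S \<union> (A - S)) (g ` S \<union> (B - g ` S))"
    using f_S f_compl by (rule bij_betw_combine) blast
  moreover have "S \<union> (A - S) = A" "g ` S \<union> (B - g ` S) = B"
    using S assms(2) by blast+
  ultimately have "bij_betw f A B"
    by simp
  moreover have "f x = g x \<or> h (f x) = x" if "x \<in> A" for x
  proof (cases "x \<in> S")
    case False
    then have "x \<in> h ` B"
      using that compl by blast
    then show ?thesis
      using False by (simp add: f_def f_inv_into_f)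
  qed (simp add: f_def)
  ultimately show thesis
    by (rule that)
qed

lemma separatedE:
  assumes "separated Z"
  obtains s where "s > 0" "\<And>z z'. z \<in> Z \<Longrightarrow> z' \<in> Z \<Longrightarrow> z \<noteq> z' \<Longrightarrow> s \<le> norm (z - z')"
proof -
  let ?D = "{ereal (norm (z - z')) | z z'. z \<in> Z \<and> z' \<in> Z \<and> z \<noteq> z'}"
  obtain s where s: "0 < ereal s" "ereal s < Inf ?D"
    using assms ereal_dense2 unfolding separated_def by blast
  have "s \<le> norm (z - z')" if "z \<in> Z" "z' \<in> Z" "z \<noteq> z'" for z z'
  proof -
    have "Inf ?D \<le> ereal (norm (z - z'))"
      using that by (intro Inf_lower) blast
    then have "ereal s \<le> ereal (norm (z - z'))"
      by (rule order.trans[OF less_imp_le[OF s(2)]])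
    then show ?thesis
      by simp
  qed
  with s(1) show thesis
    by (intro that) auto
qed

lemma netE:
  assumes "net Z"
  obtains \<rho> where "\<rho> \<ge> 0" "\<And>x. \<exists>z\<in>Z. norm (z - x) \<le> \<rho>"
proof -
  obtain \<rho> where \<rho>: "(SUP x. INF z\<in>Z. ereal (norm (z - x))) < ereal \<rho>"
    using assms ereal_dense2 unfolding net_def by blast
  have near: "\<exists>z\<in>Z. norm (z - x) \<le> \<rho>" for x
  proof -
    have "(INF z\<in>Z. ereal (norm (z - x))) < ereal \<rho>"
      using \<rho> by (metis SUP_lessD UNIV_I)
    then show ?thesis
      by (auto simp: INF_less_iff intro: less_imp_le)
  qed
  moreover have "\<rho> \<ge> 0"
    using near[of 0] by (meson norm_ge_zero order.trans)
  ultimately show thesis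
    using that by blast
qed

text \<open>The second displacement bound makes the situation symmetric, so that the same estimate
  serves whether a pair of points comes from an injection of \<open>X\<close> into \<open>Y\<close> or of \<open>Y\<close> into \<open>X\<close>.\<close>

lemma injection_of_linear_displacement:
  fixes X Y :: "(real ^ 'n) set"
  assumes "separated X" "net Y"
  obtains g C where "inj_on g X" "g ` X \<subseteq> Y"
    "\<And>x. norm (g x - x) \<le> C * (1 + norm x)" "\<And>x. norm (g x - x) \<le> C * (1 + norm (g x))"
proof -
  obtain s where s: "s > 0" "\<And>x x'. x \<in> X \<Longrightarrow> x' \<in> X \<Longrightarrow> x \<noteq> x' \<Longrightarrow> s \<le> norm (x - x')"
    using separatedE[OF assms(1)] by metis
  obtain \<rho> where \<rho>: "\<rho> \<ge> 0" "\<And>x. \<exists>y\<in>Y. norm (y - x) \<le> \<rho>"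
    using netE[OF assms(2)] by metis
  \<comment> \<open>The summand \<open>2\<close> makes \<open>L * s\<close> strictly larger than \<open>2 * \<rho>\<close> and \<open>L\<close> at least \<open>1\<close>.\<close>
  define L where "L = 2 * \<rho> / s + 2"
  have L: "L \<ge> 1" "L * s > 2 * \<rho>"
    using s(1) \<rho>(1) by (auto simp: L_def field_simps)
  have "\<forall>x. \<exists>y. y \<in> Y \<and> norm (y - L *\<^sub>R x) \<le> \<rho>"
    using \<rho>(2) by blast
  then obtain g where "\<forall>x. g x \<in> Y \<and> norm (g x - L *\<^sub>R x) \<le> \<rho>"
    by (rule choice[THEN exE])
  then have g: "g x \<in> Y" "norm (g x - L *\<^sub>R x) \<le> \<rho>" for x
    by auto
  have image: "g ` X \<subseteq> Y"
    using g(1) by blast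
  have inj: "inj_on g X"
  proof (rule inj_onI, rule ccontr)
    fix x x' assume x: "x \<in> X" "x' \<in> X" "g x = g x'" "x \<noteq> x'"
    have "L * s \<le> norm (L *\<^sub>R x - L *\<^sub>R x')"
      using s(2)[OF x(1,2,4)] L(1) by (simp flip: scaleR_diff_right)
    also have "\<dots> = norm ((g x' - L *\<^sub>R x') - (g x - L *\<^sub>R x))"
      using x(3) by simp
    also have "\<dots> \<le> 2 * \<rho>"
      using norm_triangle_ineq4[of "g x' - L *\<^sub>R x'" "g x - L *\<^sub>R x"] g(2)[of x] g(2)[of x'] by linarith
    finally show False
      using L(2) by simp
  qed
  have move: "norm (g x - x) \<le> \<rho> + (L - 1) * norm x" for x
  proof -
    have "g x - x = (g x - L *\<^sub>R x) + (L - 1) *\<^sub>R x"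
      by (simp add: algebra_simps)
    then have "norm (g x - x) \<le> norm (g x - L *\<^sub>R x) + norm ((L - 1) *\<^sub>R x)"
      by (metis norm_triangle_ineq)
    then show ?thesis
      using g(2)[of x] L(1) by simp
  qed
  have preimage: "norm x \<le> norm (g x) + \<rho>" for x
  proof -
    have "norm x \<le> L * norm x"
      using L(1) mult_right_mono[of 1 L "norm x"] by simp
    also have "\<dots> = norm (g x - (g x - L *\<^sub>R x))"
      using L(1) by simp
    also have "\<dots> \<le> norm (g x) + norm (g x - L *\<^sub>R x)"
      by (rule norm_triangle_ineq4)
    finally show ?thesis
      using g(2)[of x] by linarith
  qed
  \<comment> \<open>The coefficient needed for the second bound: \<open>\<rho> + (L - 1) * (t + \<rho>) \<le> (\<rho> + 1) * L * (1 + t)\<close>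
    for \<open>t \<ge> 0\<close>; it serves for the first one too.\<close>
  define C where "C = (\<rho> + 1) * L"
  have C: "\<rho> + (L - 1) * (t + \<rho>) \<le> C * (1 + t)" if "t \<ge> 0" for t
  proof -
    have "C * (1 + t) - (\<rho> + (L - 1) * (t + \<rho>)) = L + \<rho> * L * t + t"
      by (simp add: C_def algebra_simps)
    then show ?thesis
      using L(1) \<rho>(1) that by (smt (verit) mult_nonneg_nonneg)
  qed
  have "norm (g x - x) \<le> C * (1 + norm x)" for x
  proof -
    have "(L - 1) * norm x \<le> (L - 1) * (norm x + \<rho>)"
      using L(1) \<rho>(1) by (intro mult_left_mono) auto
    then show ?thesis
      using move[of x] C[of "norm x"] by simp
  qed
  moreover have "norm (g x - x) \<le> C * (1 + norm (g x))" for x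
  proof -
    have "(L - 1) * norm x \<le> (L - 1) * (norm (g x) + \<rho>)"
      using L(1) preimage[of x] by (intro mult_left_mono) auto
    then show ?thesis
      using move[of x] C[of "norm (g x)"] by simp
  qed
  ultimately show thesis
    by (rule that[OF inj image])
qed

lemma linear_growth_disp:
  assumes "\<And>x. x \<in> A \<Longrightarrow> norm (f x - x) \<le> C * (1 + norm x)"
  shows "linear_growth (disp A f)"
proof -
  define K where "K = max C 0"
  have "disp A f R / ereal R \<le> ereal (2 * K)" if "R \<ge> 1" for R
  proof -
    have "norm (f x - x) \<le> 2 * K * R" if "x \<in> A" "norm x \<le> R" for x
    proof -
      have "norm (f x - x) \<le> C * (1 + norm x)"
        using that(1) by (rule assms)
      also have "\<dots> \<le> K * (1 + norm x)"
        unfolding K_def by (intro mult_right_mono) auto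
      also have "\<dots> \<le> K * (2 * R)"
        using \<open>R \<ge> 1\<close> that(2) unfolding K_def by (intro mult_left_mono) auto
      finally show ?thesis
        by (simp add: mult_ac)
    qed
    then have "disp A f R \<le> ereal (2 * K * R)"
      using \<open>R \<ge> 1\<close> by (auto simp: disp_def K_def intro!: Sup_least)
    then show ?thesis
      using \<open>R \<ge> 1\<close> by (simp add: ereal_divide_le_pos mult_ac)
  qed
  then have "Limsup at_top (\<lambda>R. disp A f R / ereal R) \<le> ereal (2 * K)"
    by (intro Limsup_bounded eventually_mono[OF eventually_ge_at_top[of 1]])
  also have "\<dots> < \<infinity>"
    by simp
  finally show ?thesis
    unfolding linear_growth_def .
qed

theorem proposition2p6:
  fixes X Y :: "(real ^ 'n) set"
  assumes "separated_net X" and "separated_net Y"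
  shows "\<exists>f. bij_betw f X Y
             \<and> linear_growth (disp X f)
             \<and> linear_growth (disp Y (inv_into X f))"
proof -
  obtain g C where g: "inj_on g X" "g ` X \<subseteq> Y"
    "\<And>x. norm (g x - x) \<le> C * (1 + norm x)" "\<And>x. norm (g x - x) \<le> C * (1 + norm (g x))"
    using injection_of_linear_displacement[of X Y] assms unfolding separated_net_def by metis
  obtain h D where h: "inj_on h Y" "h ` Y \<subseteq> X"
    "\<And>y. norm (h y - y) \<le> D * (1 + norm y)" "\<And>y. norm (h y - y) \<le> D * (1 + norm (h y))"
    using injection_of_linear_displacement[of Y X] assms unfolding separated_net_def by metis
  obtain f where f: "bij_betw f X Y" "\<And>x. x \<in> X \<Longrightarrow> f x = g x \<or> h (f x) = x"
    using Cantor_Bernstein_within_graphs[OF g(1,2) h(1,2)] by blast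
  define K where "K = max C D"
  have K: "C * (1 + norm z) \<le> K * (1 + norm z)" "D * (1 + norm z) \<le> K * (1 + norm z)"
    for z :: "real ^ 'n"
    unfolding K_def by (intro mult_right_mono; simp)+
  have source: "norm (f x - x) \<le> K * (1 + norm x)" if "x \<in> X" for x
    using f(2)[OF that] g(3)[of x] h(4)[of "f x"] K[of x] by (auto simp: norm_minus_commute)
  have target: "norm (f x - x) \<le> K * (1 + norm (f x))" if "x \<in> X" for x
    using f(2)[OF that] g(4)[of x] h(3)[of "f x"] K[of "f x"] by (auto simp: norm_minus_commute)
  have "norm (inv_into X f y - y) \<le> K * (1 + norm y)" if "y \<in> Y" for y
    using target[of "inv_into X f y"] bij_betw_inv_into_right[OF f(1) that]
      bij_betw_apply[OF bij_betw_inv_into[OF f(1)] that]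
    by (simp add: norm_minus_commute)
  then show ?thesis
    using f(1) source by (blast intro: linear_growth_disp)
qed

end
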